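(* Let $T$ be a semi-infinite banded stochastic matrix ($p$ subdiagonals, $q$ superdiagonals) admitting a positive bidiagonal factorization, let $N\in\mathbb N_0$, and let $\hat T^{[N]}=\frac{1}{\lambda_0^{[N]}}\delta(u_0^{\langle N\rangle})^{-1}T^{[N]}\delta(u_0^{\langle N\rangle})$. Then the probability distribution $$\pi^{[N]}=(\pi^{[N]}_0,\pi^{[N]}_1,\dots,\pi^{[N]}_N):=w_0^{\langle N\rangle}\,\delta(u_0^{\langle N\rangle}),$$ that has entries $$\pi^{[N]}_m=u^{\langle N\rangle}_{0,m}w^{\langle N\rangle}_{0,m}=\sum_{a=1}^p\sum_{b=1}^q B_{m}^{(b)}\big(\lambda^{[N]}_0\big)A_{m}^{(a)}\big(\lambda^{[N]}_0\big)\rho^{[N]}_{0,b}\mu^{[N]}_{0,a}=\frac{\alpha_N\,Q_{m,N}\big(\lambda^{[N]}_0\big)R_{m,N}\big(\lambda^{[N]}_0\big)}{P_{N}\big(\lambda^{[N]}_0\big)P'_{N+1}\big(\lambda^{[N]}_0\big)},$$ is stationary for $\hat T^{[N]}$, i.e. $\pi^{[N]}$ is a probability vector and $\pi^{[N]}\hat T^{[N]}=\pi^{[N]}$.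
   Context: A probability vector is a row vector with nonnegative entries summing to $1$. Semi-infinite matrices are indexed by $\mathbb N_0$. $p,q\ge1$ are integers. $T$ is stochastic (nonnegative entries, rows sum to $1$) and banded: $T_{n,m}=0$ unless $n-p\le m\le n+q$, with positive entries inside the band. A positive bidiagonal factorization is $T=\mathscr L_1\cdots\mathscr L_p\mathscr U_q\cdots\mathscr U_1$ with each $\mathscr L_i$ lower bidiagonal with positive main diagonal and first subdiagonal, and each $\mathscr U_j$ upper bidiagonal with positive main diagonal and first superdiagonal (all other entries zero). $\delta(v)$ is the diagonal matrix with diagonal $v$. $T^{[N]}=(T_{n,m})_{n,m=0}^N$; its eigenvalues $\lambda_0^{[N]}>\dots>\lambda_N^{[N]}$ are simple and positive (known). Recursion polynomials. Fix real unitriangular lower matrices $\nu\in\mathbb R^{p\times p}$ and $\xi\in\mathbb R^{q\times q}$ (ones on the diagonal, zeros above). For $a\in\{1,\dots,p\}$, the polynomials $A^{(a)}_n(x)$, $n\ge0$, are determined by $A^{(a)}_n=\nu_{n+1,a}$ for $0\le n\le p-1$ and $\sum_{l\ge0}A^{(a)}_l T_{l,n}=xA^{(a)}_n$, $n\ge0$. For $b\in\{1,\dots,q\}$, $B^{(b)}_n(x)$ are determined by $B^{(b)}_n=\xi_{n+1,b}$ for $0\le n\le q-1$ and $\sum_{l\ge0}T_{n,l}B^{(b)}_l=xB^{(b)}_n$, $n\ge0$. Let $P_0=1$, $P_{M}(x)=\det(xI_{M}-T^{[M-1]})$ for $M\ge1$; $\alpha_0=\beta_0=1$, $\alpha_N=(-1)^{(p-1)N}T_{p,0}\cdots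 T_{N+p-1,N-1}$, $\beta_N=(-1)^{(q-1)N}T_{0,q}\cdots T_{N-1,N+q-1}$ for $N\ge 1$. For $n\ge0$, $Q_{n,N}$ is the $p\times p$ determinant with rows $(A^{(1)}_l,\dots,A^{(p)}_l)$, $l=n,N+1,\dots,N+p-1$ (in this order), and $R_{n,N}$ is the $q\times q$ determinant with rows $(B^{(1)}_l,\dots,B^{(q)}_l)$, $l=n,N+1,\dots,N+q-1$. Eigenvectors: $u^{\langle N\rangle}_{k,n}=\beta_N R_{n,N}(\lambda_k^{[N]})$ and $w^{\langle N\rangle}_{k,n}=\dfrac{\alpha_N Q_{n,N}(\lambda_k^{[N]})}{P_N(\lambda_k^{[N]})P_{N+1}'(\lambda_k^{[N]})}$ for $n\ge 0$ (so $u_{k,n}^{\langle N\rangle}=0$ for $N<n\le N+q-1$ and $w_{k,n}^{\langle N\rangle}=0$ for $N<n\le N+p-1$). Known facts: $u^{\langle N\rangle}_k=(u_{k,n}^{\langle N\rangle})_{n=0}^N$ (column) and $w^{\langle N\rangle}_k=(w_{k,n}^{\langle N\rangle})_{n=0}^N$ (row) are right and left eigenvectors of $T^{[N]}$ for $\lambda_k^{[N]}$, with $w_k^{\langle N\rangle}u_l^{\langle N\rangle}=\delta_{k,l}$, and $u^{\langle N\rangle}_0,w^{\langle N\rangle}_0$ have all entries positive. Christoffel numbers: $(\mu_{k,1}^{[N]},\dots,\mu_{k,p}^{[N]})^\top=\nu^{-1}(w_{k,0}^{\langle N\rangle},\dots,w_{k,p-1}^{\langle N\rangle})^\top$, $(\rho_{k,1}^{[N]},\dots,\rho_{k,q}^{[N]})^\top=\xi^{-1}(u_{k,0}^{\langle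 N\rangle},\dots,u_{k,q-1}^{\langle N\rangle})^\top$; one has $w_{k,n}^{\langle N\rangle}=\sum_a A_n^{(a)}(\lambda_k^{[N]})\mu_{k,a}^{[N]}$, $u_{k,n}^{\langle N\rangle}=\sum_b B_n^{(b)}(\lambda_k^{[N]})\rho_{k,b}^{[N]}$.
   Formalization: The last displayed formula for $\pi^{[N]}_m$ is proved with the additional factor $\beta_N$ in the numerator, i.e. $\alpha_N\beta_N Q_{m,N}R_{m,N}/(P_N P'_{N+1})$; as printed, without $\beta_N$, it fails for every $N\ge1$ since $0<|\beta_N|<1$. *)

theory Defs
  imports
    Complex_Main
    "Jordan_Normal_Form.Char_Poly"
    "Jordan_Normal_Form.Gauss_Jordan_Elimination"
begin

section \<open>Semi-infinite matrices\<close>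

text \<open>Semi-infinite real matrices are functions on pairs of natural numbers, indexed from 0.
  Finite vectors and matrices are those of Jordan_Normal_Form, also indexed from 0.\<close>

type_synonym imat = "nat \<Rightarrow> nat \<Rightarrow> real"

definition stochastic_imat :: "imat \<Rightarrow> bool" where
  "stochastic_imat T \<longleftrightarrow> (\<forall>n m. 0 \<le> T n m) \<and> (\<forall>n. T n sums 1)"

text \<open>The condition \<open>n - p \<le> m\<close> on integers is written \<open>n \<le> m + p\<close> to avoid truncated subtraction.\<close>

definition positive_banded :: "nat \<Rightarrow> nat \<Rightarrow> imat \<Rightarrow> bool" where
  "positive_banded p q T \<longleftrightarrow>
     (\<forall>n m. if n \<le> m + p \<and> m \<le> n + q then 0 < T n m else T n m = 0)"

definition imat_one :: imat where
  "imat_one n m = (if n = m then 1 else 0)"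

text \<open>Only products of banded matrices are formed, for which the series has finitely many nonzero
  terms.\<close>

definition imat_mult :: "imat \<Rightarrow> imat \<Rightarrow> imat" where
  "imat_mult X Y n m = (\<Sum>k. X n k * Y k m)"

definition imat_prod_list :: "imat list \<Rightarrow> imat" where
  "imat_prod_list Xs = foldr imat_mult Xs imat_one"

definition pos_lower_bidiagonal :: "imat \<Rightarrow> bool" where
  "pos_lower_bidiagonal L \<longleftrightarrow>
     (\<forall>n m. if n = m \<or> n = Suc m then 0 < L n m else L n m = 0)"

definition pos_upper_bidiagonal :: "imat \<Rightarrow> bool" where
  "pos_upper_bidiagonal U \<longleftrightarrow>
     (\<forall>n m. if m = n \<or> m = Suc n then 0 < U n m else U n m = 0)"

text \<open>\<open>T = L 1 \<cdots> L p U q \<cdots> U 1\<close>\<close>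

definition has_pos_bidiagonal_factorization :: "nat \<Rightarrow> nat \<Rightarrow> imat \<Rightarrow> bool" where
  "has_pos_bidiagonal_factorization p q T \<longleftrightarrow>
     (\<exists>L U. (\<forall>i\<in>{1..p}. pos_lower_bidiagonal (L i)) \<and>
            (\<forall>j\<in>{1..q}. pos_upper_bidiagonal (U j)) \<and>
            T = imat_prod_list (map L [1..<Suc p] @ map U (rev [1..<Suc q])))"


section \<open>Truncations, their characteristic polynomials and eigenvalues\<close>

definition trunc :: "imat \<Rightarrow> nat \<Rightarrow> real mat" where
  "trunc T N = mat (Suc N) (Suc N) (\<lambda>(n, m). T n m)"

fun trunc_char_poly :: "imat \<Rightarrow> nat \<Rightarrow> real poly" where
  "trunc_char_poly T 0 = 1"
| "trunc_char_poly T (Suc N) = char_poly (trunc T N)"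

text \<open>The \<open>k\<close>-th eigenvalue of the truncation, in decreasing order, starting with \<open>k = 0\<close>.\<close>

definition eigval :: "imat \<Rightarrow> nat \<Rightarrow> nat \<Rightarrow> real" where
  "eigval T N k = rev (sorted_list_of_set {x. eigenvalue (trunc T N) x}) ! k"


section \<open>Recursion polynomials\<close>

definition lower_unitriangular :: "nat \<Rightarrow> real mat \<Rightarrow> bool" where
  "lower_unitriangular r M \<longleftrightarrow> M \<in> carrier_mat r r \<and>
     (\<forall>i<r. M $$ (i, i) = 1) \<and> (\<forall>i<r. \<forall>j<r. i < j \<longrightarrow> M $$ (i, j) = 0)"

text \<open>The superscripts are numbered from 0: \<open>A a n\<close> (for \<open>a < p\<close>) is the polynomial usually written
  \<open>A\<^sub>n\<close> with superscript \<open>a + 1\<close>, and similarly for \<open>B b n\<close> (\<open>b < q\<close>). The sums over all \<open>l\<close> in the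
  recurrences are cut off at the last index that can contribute, since \<open>T l n = 0\<close> for \<open>l > n + p\<close>
  and \<open>T n l = 0\<close> for \<open>l > n + q\<close>.\<close>

definition left_recursion_polys ::
    "nat \<Rightarrow> imat \<Rightarrow> real mat \<Rightarrow> (nat \<Rightarrow> nat \<Rightarrow> real poly) \<Rightarrow> bool" where
  "left_recursion_polys p T \<nu> A \<longleftrightarrow>
     (\<forall>a<p. (\<forall>n<p. A a n = [:\<nu> $$ (n, a):]) \<and>
            (\<forall>n. (\<Sum>l\<le>n + p. Polynomial.smult (T l n) (A a l)) = [:0, 1:] * A a n))"

definition right_recursion_polys ::
    "nat \<Rightarrow> imat \<Rightarrow> real mat \<Rightarrow> (nat \<Rightarrow> nat \<Rightarrow> real poly) \<Rightarrow> bool" where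
  "right_recursion_polys q T \<xi> B \<longleftrightarrow>
     (\<forall>b<q. (\<forall>n<q. B b n = [:\<xi> $$ (n, b):]) \<and>
            (\<forall>n. (\<Sum>l\<le>n + q. Polynomial.smult (T n l) (B b l)) = [:0, 1:] * B b n))"

text \<open>Row 0 of these determinants carries the index \<open>n\<close>, row \<open>i \<ge> 1\<close> the index \<open>N + i\<close>.\<close>

definition Q_det :: "nat \<Rightarrow> (nat \<Rightarrow> nat \<Rightarrow> real poly) \<Rightarrow> nat \<Rightarrow> nat \<Rightarrow> real poly" where
  "Q_det p A n N = det (mat p p (\<lambda>(i, c). A c (if i = 0 then n else N + i)))"

definition R_det :: "nat \<Rightarrow> (nat \<Rightarrow> nat \<Rightarrow> real poly) \<Rightarrow> nat \<Rightarrow> nat \<Rightarrow> real poly" where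
  "R_det q B n N = det (mat q q (\<lambda>(i, c). B c (if i = 0 then n else N + i)))"

definition alpha :: "nat \<Rightarrow> imat \<Rightarrow> nat \<Rightarrow> real" where
  "alpha p T N = (-1) ^ ((p - 1) * N) * (\<Prod>i<N. T (p + i) i)"

definition beta :: "nat \<Rightarrow> imat \<Rightarrow> nat \<Rightarrow> real" where
  "beta q T N = (-1) ^ ((q - 1) * N) * (\<Prod>i<N. T i (q + i))"


section \<open>Eigenvectors and Christoffel numbers\<close>

definition right_ev ::
    "nat \<Rightarrow> imat \<Rightarrow> (nat \<Rightarrow> nat \<Rightarrow> real poly) \<Rightarrow> nat \<Rightarrow> nat \<Rightarrow> nat \<Rightarrow> real" where
  "right_ev q T B N k n = beta q T N * poly (R_det q B n N) (eigval T N k)"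

definition left_ev ::
    "nat \<Rightarrow> imat \<Rightarrow> (nat \<Rightarrow> nat \<Rightarrow> real poly) \<Rightarrow> nat \<Rightarrow> nat \<Rightarrow> nat \<Rightarrow> real" where
  "left_ev p T A N k n =
     alpha p T N * poly (Q_det p A n N) (eigval T N k) /
     (poly (trunc_char_poly T N) (eigval T N k) *
      poly (pderiv (trunc_char_poly T (Suc N))) (eigval T N k))"

definition christoffel_mu ::
    "nat \<Rightarrow> imat \<Rightarrow> real mat \<Rightarrow> (nat \<Rightarrow> nat \<Rightarrow> real poly) \<Rightarrow> nat \<Rightarrow> nat \<Rightarrow> real vec" where
  "christoffel_mu p T \<nu> A N k = the (mat_inverse \<nu>) *\<^sub>v vec p (left_ev p T A N k)"

definition christoffel_rho ::
    "nat \<Rightarrow> imat \<Rightarrow> real mat \<Rightarrow> (nat \<Rightarrow> nat \<Rightarrow> real poly) \<Rightarrow> nat \<Rightarrow> nat \<Rightarrow> real vec" where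
  "christoffel_rho q T \<xi> B N k = the (mat_inverse \<xi>) *\<^sub>v vec q (right_ev q T B N k)"


section \<open>The normalized truncation and its distribution\<close>

definition diag_of_vec :: "real vec \<Rightarrow> real mat" where
  "diag_of_vec v = mat_diag (dim_vec v) (\<lambda>i. v $ i)"

text \<open>Product of a row vector with a matrix.\<close>

definition row_mult :: "real vec \<Rightarrow> real mat \<Rightarrow> real vec" where
  "row_mult v M = vec (dim_col M) (\<lambda>j. v \<bullet> col M j)"

definition probability_vec :: "real vec \<Rightarrow> bool" where
  "probability_vec v \<longleftrightarrow> (\<forall>i<dim_vec v. 0 \<le> v $ i) \<and> (\<Sum>i<dim_vec v. v $ i) = 1"

definition T_hat ::
    "nat \<Rightarrow> imat \<Rightarrow> (nat \<Rightarrow> nat \<Rightarrow> real poly) \<Rightarrow> nat \<Rightarrow> real mat" where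
  "T_hat q T B N =
     (let D = diag_of_vec (vec (Suc N) (right_ev q T B N 0))
      in (1 / eigval T N 0) \<cdot>\<^sub>m (the (mat_inverse D) * trunc T N * D))"

text \<open>Entry \<open>m\<close> of this vector is the product of \<open>right_ev\<close> and \<open>left_ev\<close>, so its closed form in terms of
  the determinants carries both factors \<open>alpha\<close> and \<open>beta\<close>.\<close>

definition pi_dist ::
    "nat \<Rightarrow> nat \<Rightarrow> imat \<Rightarrow> (nat \<Rightarrow> nat \<Rightarrow> real poly) \<Rightarrow> (nat \<Rightarrow> nat \<Rightarrow> real poly) \<Rightarrow> nat \<Rightarrow> real vec" where
  "pi_dist p q T A B N =
     row_mult (vec (Suc N) (left_ev p T A N 0))
       (diag_of_vec (vec (Suc N) (right_ev q T B N 0)))"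

end

theory Submission
  imports Defs
begin

text \<open>
  Let \<open>G\<close> be the adjugate of \<open>X - T\<close>, truncated to the indices up to \<open>N\<close>, over the polynomial
  ring. Up to the factors \<open>beta\<close> and \<open>alpha\<close>, the determinants \<open>R_det\<close> and \<open>Q_det\<close> are the
  entries of the last column and the last row of \<open>G\<close>: as
  combinations of recursion polynomials with coefficients independent of \<open>n\<close> they satisfy the
  truncated recurrence up to a multiple of the last unit vector, and Cramer's rule together with
  induction on \<open>N\<close> identifies the multiple.

  Bordering a truncation by one row and column expresses \<open>G\<close> through the previous adjugate. It
  follows by induction on \<open>N\<close> that at the largest root of the characteristic polynomial all entries
  of \<open>G\<close> are positive, so both eigenvectors are positive there. Their pairing is evaluated
  by differentiating a Christoffel-Darboux identity, and conjugating the left eigenvector equation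
  by the diagonal matrix of the right eigenvector gives stationarity.
\<close>

section \<open>Adjugates of truncations\<close>

definition trunc_charmat :: "imat \<Rightarrow> nat \<Rightarrow> real poly mat" where
  "trunc_charmat T n = char_poly_matrix (mat n n (\<lambda>(i, j). T i j))"

definition trunc_adj :: "imat \<Rightarrow> nat \<Rightarrow> nat \<Rightarrow> nat \<Rightarrow> real poly" where
  "trunc_adj T n i j = adj_mat (trunc_charmat T n) $$ (i, j)"

lemma trunc_charmat_carrier [simp]: "trunc_charmat T n \<in> carrier_mat n n"
  by (simp add: trunc_charmat_def)

lemma trunc_charmat_dim [simp]:
  "dim_row (trunc_charmat T n) = n" "dim_col (trunc_charmat T n) = n"
  by (rule carrier_matD[OF trunc_charmat_carrier])+

lemma trunc_charmat_index:
  "i < n \<Longrightarrow> j < n \<Longrightarrow> trunc_charmat T n $$ (i, j) = (if i = j then [:0, 1:] else 0) - [:T i j:]"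
  by (auto simp: trunc_charmat_def char_poly_matrix_def)

declare trunc_char_poly.simps(2) [simp del]

lemma trunc_char_poly_eq_det: "trunc_char_poly T n = det (trunc_charmat T n)"
  by (cases n) (simp_all add: trunc_char_poly.simps trunc_charmat_def char_poly_def trunc_def)

lemma trunc_adj_cofactor:
  "i < n \<Longrightarrow> j < n \<Longrightarrow> trunc_adj T n i j = cofactor (trunc_charmat T n) j i"
  by (simp add: trunc_adj_def adj_mat_def)

text \<open>The pattern \<open>\<lambda>i j. T j i\<close> matches every matrix, so as rewrite rules the following facts
  terminate only with \<open>T\<close> instantiated.\<close>

lemma trunc_charmat_transpose:
  "trunc_charmat (\<lambda>i j. T j i) n = transpose_mat (trunc_charmat T n)"
  by (rule eq_matI) (auto simp: trunc_charmat_index)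

lemma trunc_char_poly_transpose: "trunc_char_poly (\<lambda>i j. T j i) n = trunc_char_poly T n"
  by (simp add: trunc_char_poly_eq_det trunc_charmat_transpose[of T] det_transpose[of _ n])

lemma trunc_adj_transpose:
  assumes "i < n" "j < n"
  shows "trunc_adj (\<lambda>i j. T j i) n i j = trunc_adj T n j i"
proof -
  have "mat_delete (transpose_mat (trunc_charmat T n)) j i = transpose_mat (mat_delete (trunc_charmat T n) i j)"
    using assms by (intro eq_matI) (auto simp: mat_delete_def)
  moreover have "det (transpose_mat (mat_delete (trunc_charmat T n) i j)) = det (mat_delete (trunc_charmat T n) i j)"
    by (rule det_transpose[OF mat_delete_carrier[OF trunc_charmat_carrier]])
  ultimately show ?thesis
    using assms unfolding trunc_adj_cofactor[OF assms] trunc_adj_cofactor[OF assms(2,1)]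
    by (simp only: trunc_charmat_transpose[of T] cofactor_def add.commute[of i j])
qed

lemma trunc_charmat_mult:
  assumes "i < n"
  shows "(\<Sum>k<n. trunc_charmat T n $$ (i, k) * v k) = [:0, 1:] * v i - (\<Sum>k<n. Polynomial.smult (T i k) (v k))"
proof -
  have "(\<Sum>k<n. trunc_charmat T n $$ (i, k) * v k) =
        (\<Sum>k<n. (if k = i then [:0, 1:] * v i else 0) - Polynomial.smult (T i k) (v k))"
    using assms by (intro sum.cong) (auto simp: trunc_charmat_index left_diff_distrib)
  also have "\<dots> = [:0, 1:] * v i - (\<Sum>k<n. Polynomial.smult (T i k) (v k))"
    using assms by (simp add: sum_subtractf)
  finally show ?thesis .
qed

lemma trunc_charmat_mult_adj:
  assumes "i < n" "j < n"
  shows "[:0, 1:] * trunc_adj T n i j - (\<Sum>k<n. Polynomial.smult (T i k) (trunc_adj T n k j)) =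
         (if i = j then trunc_char_poly T n else 0)"
proof -
  let ?K = "trunc_charmat T n"
  have "(?K * adj_mat ?K) $$ (i, j) = (\<Sum>k<n. ?K $$ (i, k) * trunc_adj T n k j)"
    using assms adj_mat(1)[of ?K n]
    by (auto simp: scalar_prod_def trunc_adj_def lessThan_atLeast0 intro!: sum.cong)
  then show ?thesis
    using assms adj_mat(2)[of ?K n]
    by (auto simp: trunc_charmat_mult trunc_char_poly_eq_det split: if_splits)
qed

lemma trunc_adj_mult_charmat:
  assumes "i < n" "k < n"
  shows "(\<Sum>j<n. trunc_adj T n i j * trunc_charmat T n $$ (j, k)) =
         (if i = k then trunc_char_poly T n else 0)"
proof -
  let ?K = "trunc_charmat T n"
  have "(adj_mat ?K * ?K) $$ (i, k) = (\<Sum>j<n. trunc_adj T n i j * ?K $$ (j, k))"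
    using assms adj_mat(1)[of ?K n]
    by (auto simp: scalar_prod_def trunc_adj_def lessThan_atLeast0 intro!: sum.cong)
  then show ?thesis
    using assms adj_mat(3)[of ?K n] by (auto simp: trunc_char_poly_eq_det split: if_splits)
qed

lemma trunc_cramer:
  assumes eq: "\<And>i. i < n \<Longrightarrow> [:0, 1:] * v i - (\<Sum>k<n. Polynomial.smult (T i k) (v k)) = b i"
    and "i < n"
  shows "trunc_char_poly T n * v i = (\<Sum>j<n. trunc_adj T n i j * b j)"
proof -
  let ?K = "trunc_charmat T n"
  have "(\<Sum>j<n. trunc_adj T n i j * b j) = (\<Sum>j<n. trunc_adj T n i j * (\<Sum>k<n. ?K $$ (j, k) * v k))"
    by (rule sum.cong) (simp_all only: trunc_charmat_mult eq lessThan_iff)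
  also have "\<dots> = (\<Sum>k<n. (\<Sum>j<n. trunc_adj T n i j * ?K $$ (j, k)) * v k)"
    unfolding sum_distrib_left sum_distrib_right by (subst sum.swap) (simp add: mult.assoc)
  also have "\<dots> = (\<Sum>k<n. if k = i then trunc_char_poly T n * v i else 0)"
    using \<open>i < n\<close> by (intro sum.cong) (auto simp: trunc_adj_mult_charmat)
  also have "\<dots> = trunc_char_poly T n * v i"
    using \<open>i < n\<close> by simp
  finally show ?thesis by simp
qed

lemma trunc_char_poly_monic: "degree (trunc_char_poly T n) = n \<and> coeff (trunc_char_poly T n) n = 1"
  by (cases n) (simp_all add: trunc_char_poly.simps degree_monic_char_poly trunc_def)

lemma trunc_char_poly_nonzero [simp]: "trunc_char_poly T n \<noteq> 0"
  using trunc_char_poly_monic[of T n] by auto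

lemma trunc_adj_corner: "trunc_adj T (Suc n) n n = trunc_char_poly T n"
proof -
  have "mat_delete (trunc_charmat T (Suc n)) n n = trunc_charmat T n"
    by (rule eq_matI) (auto simp: mat_delete_def trunc_charmat_index)
  then show ?thesis
    by (simp add: trunc_adj_cofactor cofactor_def trunc_char_poly_eq_det)
qed

lemma trunc_adj_last_col:
  assumes "i < n"
  shows "trunc_adj T (Suc n) i n = (\<Sum>j<n. Polynomial.smult (T j n) (trunc_adj T n i j))"
proof -
  have "trunc_char_poly T n * trunc_adj T (Suc n) i n =
        (\<Sum>j<n. trunc_adj T n i j * Polynomial.smult (T j n) (trunc_char_poly T n))"
  proof (rule trunc_cramer[OF _ assms])
    fix i assume "i < n"
    then show "[:0, 1:] * trunc_adj T (Suc n) i n - (\<Sum>k<n. Polynomial.smult (T i k) (trunc_adj T (Suc n) k n)) =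
        Polynomial.smult (T i n) (trunc_char_poly T n)"
      using trunc_charmat_mult_adj[of i "Suc n" n T] by (simp add: trunc_adj_corner algebra_simps)
  qed
  also have "\<dots> = trunc_char_poly T n * (\<Sum>j<n. Polynomial.smult (T j n) (trunc_adj T n i j))"
    by (simp add: sum_distrib_left mult.commute)
  finally show ?thesis by simp
qed

lemma trunc_adj_last_row:
  assumes "j < n"
  shows "trunc_adj T (Suc n) n j = (\<Sum>i<n. Polynomial.smult (T n i) (trunc_adj T n i j))"
  using trunc_adj_last_col[OF assms, of "\<lambda>i j. T j i"] assms by (simp add: trunc_adj_transpose[where T = T])

lemma trunc_char_poly_Suc:
  "trunc_char_poly T (Suc n) =
     [:- T n n, 1:] * trunc_char_poly T n - (\<Sum>k<n. Polynomial.smult (T n k) (trunc_adj T (Suc n) k n))"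
  using trunc_charmat_mult_adj[of n "Suc n" n T]
  by (simp add: trunc_adj_corner algebra_simps)

lemma trunc_adj_block:
  assumes "i < n" "j < n"
  shows "trunc_char_poly T n * trunc_adj T (Suc n) i j =
         trunc_char_poly T (Suc n) * trunc_adj T n i j + trunc_adj T (Suc n) i n * trunc_adj T (Suc n) n j"
proof -
  let ?P = "trunc_char_poly T (Suc n)" and ?r = "trunc_adj T (Suc n) n j"
  have "trunc_char_poly T n * trunc_adj T (Suc n) i j =
        (\<Sum>l<n. trunc_adj T n i l * ((if l = j then ?P else 0) + Polynomial.smult (T l n) ?r))"
  proof (rule trunc_cramer[OF _ assms(1)])
    fix l assume "l < n"
    then show "[:0, 1:] * trunc_adj T (Suc n) l j - (\<Sum>k<n. Polynomial.smult (T l k) (trunc_adj T (Suc n) k j)) =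
        (if l = j then ?P else 0) + Polynomial.smult (T l n) ?r"
      using trunc_charmat_mult_adj[of l "Suc n" j T] assms
      by (simp add: algebra_simps)
  qed
  also have "\<dots> = (\<Sum>l<n. if l = j then ?P * trunc_adj T n i j else 0) +
      (\<Sum>l<n. Polynomial.smult (T l n) (trunc_adj T n i l)) * ?r"
    unfolding sum_distrib_right sum.distrib[symmetric]
    by (intro sum.cong) (auto simp: algebra_simps)
  also have "\<dots> = ?P * trunc_adj T n i j + trunc_adj T (Suc n) i n * ?r"
    using assms by (simp add: trunc_adj_last_col)
  finally show ?thesis .
qed

text \<open>At the largest root \<open>r\<close> for size \<open>n\<close> the next characteristic polynomial is negative, so its
  largest root \<open>s\<close> exceeds \<open>r\<close>; for \<open>x \<ge> s\<close> every term of the bordering identity \<open>trunc_adj_block\<close> is then nonnegative and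
  its last summand is positive.\<close>

lemma trunc_adj_perron:
  assumes nonneg: "\<And>i j. 0 \<le> T i j" and diag: "0 < T 0 0"
    and super: "\<And>i. 0 < T i (Suc i)" and sub: "\<And>i. 0 < T (Suc i) i"
  shows "\<exists>r>0. poly (trunc_char_poly T (Suc n)) r = 0 \<and>
    (\<forall>x>r. 0 < poly (trunc_char_poly T (Suc n)) x) \<and>
    (\<forall>x\<ge>r. \<forall>i\<le>n. \<forall>j\<le>n. 0 < poly (trunc_adj T (Suc n) i j) x)"
proof (induction n)
  case 0
  have "trunc_char_poly T (Suc 0) = [:- T 0 0, 1:]" "trunc_adj T (Suc 0) 0 0 = 1"
    using trunc_char_poly_Suc[of T 0] trunc_adj_corner[of T 0] by simp_all
  then show ?case
    using diag by (intro exI[of _ "T 0 0"]) simp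
next
  case (Suc m)
  let ?n = "Suc m"
  let ?P = "trunc_char_poly T ?n" and ?P' = "trunc_char_poly T (Suc ?n)"
  obtain r where r: "r > 0" "poly ?P r = 0" "\<And>x. x > r \<Longrightarrow> 0 < poly ?P x"
    and adj: "\<And>x i j. r \<le> x \<Longrightarrow> i \<le> m \<Longrightarrow> j \<le> m \<Longrightarrow> 0 < poly (trunc_adj T ?n i j) x"
    using Suc.IH by blast
  have sum_pos: "0 < (\<Sum>j<?n. a j * g j)" if "\<And>j. j < ?n \<Longrightarrow> 0 \<le> a j" "0 < a m" "\<And>j. j < ?n \<Longrightarrow> 0 < g j"
    for a g :: "nat \<Rightarrow> real"
    using that by (intro sum_pos2[of _ m]) (auto simp: less_imp_le)
  have col: "0 < poly (trunc_adj T (Suc ?n) i ?n) x" if "r \<le> x" "i \<le> m" for i x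
    using that adj[of x i] super[of m] nonneg
    by (simp add: trunc_adj_last_col poly_sum del: sum.lessThan_Suc) (rule sum_pos, auto)
  have row: "0 < poly (trunc_adj T (Suc ?n) ?n j) x" if "r \<le> x" "j \<le> m" for j x
    using that adj[of x _ j] sub[of m] nonneg
    by (simp add: trunc_adj_last_row poly_sum del: sum.lessThan_Suc) (rule sum_pos, auto)
  have "0 < (\<Sum>k<?n. T ?n k * poly (trunc_adj T (Suc ?n) k ?n) r)"
    by (rule sum_pos) (use nonneg sub col in auto)
  then have neg: "poly ?P' r < 0"
    using r(2) by (subst trunc_char_poly_Suc) (simp add: poly_sum del: sum.lessThan_Suc)
  have lc: "0 < lead_coeff ?P'"
    using trunc_char_poly_monic[of T "Suc ?n"] by simp
  obtain b where b: "\<And>x. b \<le> x \<Longrightarrow> lead_coeff ?P' \<le> poly ?P' x"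
    using poly_pinfty_gt_lc[OF lc] by blast
  define S where "S = {x. poly ?P' x = 0}"
  have finS: "finite S"
    unfolding S_def by (rule poly_roots_finite) (rule trunc_char_poly_nonzero)
  have above: "\<exists>y\<in>S. x < y" if "poly ?P' x < 0" for x
  proof -
    have pos_max: "0 < poly ?P' (max b (x + 1))"
      using b[of "max b (x + 1)"] lc by linarith
    have "x < max b (x + 1)" by simp
    from poly_IVT_pos[OF this that pos_max] show ?thesis
      unfolding S_def mem_Collect_eq Bex_def by blast
  qed
  then have "S \<noteq> {}" using neg by blast
  define s where "s = Max S"
  have s: "poly ?P' s = 0"
    using Max_in[OF finS \<open>S \<noteq> {}\<close>] by (simp add: S_def s_def)
  have smax: "y \<le> s" if "y \<in> S" for y
    using finS that by (simp add: s_def)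
  have "r < s" using above[OF neg] smax by fastforce
  have pos: "0 < poly ?P' x" if "s < x" for x
  proof (rule ccontr)
    assume "\<not> 0 < poly ?P' x"
    then consider "poly ?P' x = 0" | "poly ?P' x < 0" by linarith
    then obtain y where "y \<in> S" "x \<le> y"
      by cases (use above[of x] in \<open>auto simp: S_def less_imp_le\<close>)
    then show False using smax that by fastforce
  qed
  have adj': "0 < poly (trunc_adj T (Suc ?n) i j) x" if ij: "s \<le> x" "i \<le> ?n" "j \<le> ?n" for x i j
  proof -
    have rx: "r < x" using \<open>r < s\<close> ij by linarith
    consider "i = ?n" "j = ?n" | "i \<le> m" "j = ?n" | "i = ?n" "j \<le> m" | "i \<le> m" "j \<le> m"
      using ij unfolding le_Suc_eq by blast
    then show ?thesis
    proof cases
      case 1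
      then show ?thesis using r(3)[OF rx] by (simp add: trunc_adj_corner)
    next
      case 4
      have "poly ?P x * poly (trunc_adj T (Suc ?n) i j) x = poly ?P' x * poly (trunc_adj T ?n i j) x +
         poly (trunc_adj T (Suc ?n) i ?n) x * poly (trunc_adj T (Suc ?n) ?n j) x"
        using 4 trunc_adj_block[of i ?n j T]
        by (simp only: poly_mult[symmetric] poly_add[symmetric] less_Suc_eq_le)
      moreover have "0 \<le> poly ?P' x" using pos[of x] s ij by (cases "s = x") auto
      then have "0 \<le> poly ?P' x * poly (trunc_adj T ?n i j) x"
        using adj[of x i j] 4 rx by (intro mult_nonneg_nonneg) auto
      moreover have "0 < poly (trunc_adj T (Suc ?n) i ?n) x * poly (trunc_adj T (Suc ?n) ?n j) x"
        using col[of x i] row[of x j] 4 rx by (intro mult_pos_pos) auto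
      ultimately have "0 < poly ?P x * poly (trunc_adj T (Suc ?n) i j) x" by linarith
      then show ?thesis by (rule zero_less_mult_pos[OF _ r(3)[OF rx]])
    next
      case 2
      then show ?thesis using col[of x i] rx by simp
    next
      case 3
      then show ?thesis using row[of x j] rx by simp
    qed
  qed
  have "0 < s" using \<open>r < s\<close> r(1) by linarith
  then show ?case using s pos adj' by blast
qed

lemma eigval_0_eq:
  assumes root: "poly (trunc_char_poly T (Suc N)) r = 0"
    and pos: "\<And>x. r < x \<Longrightarrow> 0 < poly (trunc_char_poly T (Suc N)) x"
  shows "eigval T N 0 = r"
proof -
  define S where "S = {x. eigenvalue (trunc T N) x}"
  define xs where "xs = sorted_list_of_set S"
  have S: "S = {x. poly (trunc_char_poly T (Suc N)) x = 0}"
    using eigenvalue_root_char_poly[of "trunc T N" "Suc N"] by (auto simp: S_def trunc_def trunc_char_poly.simps)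
  have "finite S" unfolding S by (rule poly_roots_finite) (rule trunc_char_poly_nonzero)
  then have xs: "set xs = S" "sorted xs" by (simp_all add: xs_def)
  have "r \<in> set xs" using root unfolding xs(1) S by simp
  then obtain i where i: "i < length xs" "xs ! i = r"
    unfolding in_set_conv_nth by blast
  have "xs ! (length xs - 1) \<in> S" using i nth_mem[of "length xs - 1" xs] unfolding xs(1) by linarith
  then have "xs ! (length xs - 1) \<le> r" using pos[of "xs ! (length xs - 1)"] unfolding S
    by (cases "r < xs ! (length xs - 1)") simp_all
  moreover have "r \<le> xs ! (length xs - 1)"
    using sorted_nth_mono[OF xs(2), of i "length xs - 1"] i by auto
  ultimately show ?thesis
    using i rev_nth[of 0 xs] by (cases "xs = []") (simp_all add: eigval_def flip: S_def xs_def)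
qed

section \<open>The determinants as entries of the adjugate\<close>

lemma R_det_expand:
  assumes "0 < q"
  shows "R_det q B n N = (\<Sum>c<q. B c n * cofactor (mat q q (\<lambda>(i, c). B c (N + i))) 0 c)"
proof -
  let ?M = "mat q q (\<lambda>(i, c). B c (if i = 0 then n else N + i))"
  have "mat_delete ?M 0 c = mat_delete (mat q q (\<lambda>(i, c). B c (N + i))) 0 c" for c
    by (rule eq_matI) (auto simp: mat_delete_def)
  then have "cofactor ?M 0 c = cofactor (mat q q (\<lambda>(i, c). B c (N + i))) 0 c" for c
    by (simp add: cofactor_def)
  then show ?thesis
    using laplace_expansion_row[of ?M q 0] assms by (simp add: R_det_def)
qed

lemma R_det_eq_0:
  assumes "N < n" "n < N + q"
  shows "R_det q B n N = 0"
  unfolding R_det_def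
proof (rule det_identical_rows[of _ q 0 "n - N"])
  show "row (mat q q (\<lambda>(i, c). B c (if i = 0 then n else N + i))) 0 =
        row (mat q q (\<lambda>(i, c). B c (if i = 0 then n else N + i))) (n - N)"
    using assms by (intro eq_vecI) auto
qed (use assms in auto)

lemma R_det_shift:
  assumes "0 < q"
  shows "R_det q B (N + q) N = (-1) ^ (q - 1) * R_det q B (Suc N) (Suc N)"
proof -
  let ?M = "\<lambda>n N. mat q q (\<lambda>(i, c). B c (if i = 0 then n else N + i))"
  let ?M1 = "?M (N + q) N" and ?M2 = "?M (Suc N) (Suc N)"
  have del: "mat_delete ?M2 (q - 1) c = mat_delete ?M1 0 c" for c
    using assms by (intro eq_matI) (auto simp: mat_delete_def)
  have "R_det q B (Suc N) (Suc N) = (\<Sum>c<q. B c (N + q) * cofactor ?M2 (q - 1) c)"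
    using laplace_expansion_row[of ?M2 q "q - 1"] assms
    by (cases "q = 1") (simp_all add: R_det_def)
  also have "\<dots> = (\<Sum>c<q. (-1) ^ (q - 1) * (B c (N + q) * cofactor ?M1 0 c))"
    unfolding cofactor_def del power_add power_0 by (simp only: mult_1_left mult_ac)
  also have "\<dots> = (-1) ^ (q - 1) * R_det q B (N + q) N"
    using laplace_expansion_row[of ?M1 q 0] assms by (simp add: R_det_def sum_distrib_left)
  finally show ?thesis
    by (simp flip: mult.assoc power_add)
qed

lemma R_det_recursion:
  assumes "0 < q" "right_recursion_polys q T \<xi> B"
  shows "(\<Sum>l\<le>n + q. Polynomial.smult (T n l) (R_det q B l N)) = [:0, 1:] * R_det q B n N"
proof -
  let ?cf = "\<lambda>c. cofactor (mat q q (\<lambda>(i, c). B c (N + i))) 0 c"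
  have "(\<Sum>l\<le>n + q. Polynomial.smult (T n l) (R_det q B l N)) =
        (\<Sum>c<q. (\<Sum>l\<le>n + q. Polynomial.smult (T n l) (B c l)) * ?cf c)"
    unfolding R_det_expand[OF assms(1)] smult_sum2 sum_distrib_right
    by (subst sum.swap) simp
  also have "\<dots> = (\<Sum>c<q. ([:0, 1:] * B c n) * ?cf c)"
    using assms(2) by (intro sum.cong) (simp_all only: right_recursion_polys_def lessThan_iff)
  finally show ?thesis
    by (simp add: R_det_expand[OF assms(1)] sum_distrib_left mult.assoc del: mult_pCons_left)
qed

lemma R_det_trunc_eq:
  assumes q: "0 < q" and rec: "right_recursion_polys q T \<xi> B"
    and band: "\<And>i j. i + q < j \<Longrightarrow> T i j = 0" and "n \<le> N"
  shows "[:0, 1:] * R_det q B n N - (\<Sum>l<Suc N. Polynomial.smult (T n l) (R_det q B l N)) =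
         (if n = N then Polynomial.smult (T N (N + q)) (R_det q B (N + q) N) else 0)"
proof -
  let ?f = "\<lambda>l. Polynomial.smult (T n l) (R_det q B l N)"
  have "(\<Sum>l\<le>n + q. ?f l) = (\<Sum>l\<le>N + q. ?f l)"
    using \<open>n \<le> N\<close> by (intro sum.mono_neutral_left) (auto simp: band)
  also have "\<dots> = (\<Sum>l\<in>insert (N + q) {..<Suc N}. ?f l)"
    by (intro sum.mono_neutral_right) (auto simp: R_det_eq_0)
  also have "\<dots> = ?f (N + q) + (\<Sum>l<Suc N. ?f l)"
    using q by (subst sum.insert) auto
  finally have "[:0, 1:] * R_det q B n N - (\<Sum>l<Suc N. ?f l) = ?f (N + q)"
    unfolding R_det_recursion[OF q rec] by simp
  then show ?thesis
    using \<open>n \<le> N\<close> by (auto simp: band)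
qed

lemma beta_Suc: "beta q T (Suc N) = beta q T N * ((-1) ^ (q - 1) * T N (q + N))"
  by (simp add: beta_def power_add)

lemma det_lower_unitriangular:
  fixes M :: "'a :: comm_ring_1 mat"
  assumes "M \<in> carrier_mat r r" "\<And>i. i < r \<Longrightarrow> M $$ (i, i) = 1"
    "\<And>i j. i < j \<Longrightarrow> j < r \<Longrightarrow> M $$ (i, j) = 0"
  shows "det M = 1"
proof -
  have "det M = prod_list (diag_mat M)"
    using assms by (intro det_lower_triangular[of r]) auto
  also have "diag_mat M = map (\<lambda>_. 1) [0..<r]"
    using assms by (auto simp: diag_mat_def)
  finally show ?thesis
    by (simp add: map_replicate_const)
qed

lemma beta_R_det:
  assumes q: "0 < q" and rec: "right_recursion_polys q T \<xi> B"
    and \<xi>: "lower_unitriangular q \<xi>"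
    and band: "\<And>i j. i + q < j \<Longrightarrow> T i j = 0" and "n \<le> N"
  shows "Polynomial.smult (beta q T N) (R_det q B n N) = trunc_adj T (Suc N) n N"
proof -
  let ?P = "trunc_char_poly T" and ?R = "R_det q B"
  have cramer: "?P (Suc N) * Polynomial.smult (beta q T N) (?R n N) =
      trunc_adj T (Suc N) n N * Polynomial.smult (beta q T (Suc N)) (?R (Suc N) (Suc N))"
    if "n \<le> N" for n N
  proof -
    have "?P (Suc N) * ?R n N = (\<Sum>j<Suc N. trunc_adj T (Suc N) n j *
        (if j = N then Polynomial.smult (T N (N + q)) (?R (N + q) N) else 0))"
      by (rule trunc_cramer) (use that in \<open>auto simp: R_det_trunc_eq[OF q rec band] less_Suc_eq_le simp del: sum.lessThan_Suc mult_pCons_left\<close>)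
    also have "\<dots> = trunc_adj T (Suc N) n N * Polynomial.smult (T N (N + q)) (?R (N + q) N)"
      by simp
    finally have eq: "?P (Suc N) * ?R n N = \<dots>" .
    have sgn: "(-1) ^ k = [:(-1) ^ k :: real:]" for k
      by (induction k) (simp_all add: one_pCons)
    show ?thesis
      unfolding mult_smult_right eq R_det_shift[OF q] sgn
      by (simp add: beta_Suc mult_ac add.commute)
  qed
  have corner: "Polynomial.smult (beta q T N) (?R N N) = ?P N" for N
  proof (induction N)
    case 0
    have "?R 0 0 = det (map_mat (\<lambda>x. [:x:]) \<xi>)"
      unfolding R_det_def using rec \<xi>
      by (intro arg_cong[of _ _ det] eq_matI)
        (auto simp: right_recursion_polys_def lower_unitriangular_def)
    also have "\<dots> = 1"
      by (rule det_lower_unitriangular[of _ q]) (use \<xi> in \<open>auto simp: lower_unitriangular_def\<close>)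
    finally show ?case by (simp add: beta_def)
  next
    case (Suc N)
    have "?P N * ?P (Suc N) = ?P N * Polynomial.smult (beta q T (Suc N)) (?R (Suc N) (Suc N))"
      using cramer[of N N] by (simp only: Suc.IH trunc_adj_corner order.refl mult.commute[of "?P (Suc N)"])
    then show ?case
      by (simp only: mult_left_cancel[OF trunc_char_poly_nonzero])
  qed
  show ?thesis
    using cramer[OF \<open>n \<le> N\<close>] by (simp only: corner mult.commute[of "?P (Suc N)"] mult_right_cancel[OF trunc_char_poly_nonzero])
qed

lemma mat_inverse_mult:
  fixes M :: "'a :: field mat"
  assumes "M \<in> carrier_mat n n" "det M \<noteq> 0"
  shows "the (mat_inverse M) * M = 1\<^sub>m n" "M * the (mat_inverse M) = 1\<^sub>m n"
    "the (mat_inverse M) \<in> carrier_mat n n"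
proof -
  have "M \<in> Units (ring_mat TYPE('a) n ())"
    by (rule det_non_zero_imp_unit[OF assms])
  then obtain E where "mat_inverse M = Some E"
    using mat_inverse(1)[OF assms(1)] by fastforce
  with mat_inverse(2)[OF assms(1) this]
  show "the (mat_inverse M) * M = 1\<^sub>m n" "M * the (mat_inverse M) = 1\<^sub>m n"
    "the (mat_inverse M) \<in> carrier_mat n n" by simp_all
qed

lemma christoffel_coeff:
  assumes \<xi>: "lower_unitriangular q \<xi>" and "right_recursion_polys q T \<xi> B"
    and u: "\<And>n. u n = (\<Sum>b<q. poly (B b n) x * g b)" and "b < q"
  shows "(the (mat_inverse \<xi>) *\<^sub>v vec q u) $ b = g b"
proof -
  have carrier: "\<xi> \<in> carrier_mat q q"
    using \<xi> by (simp add: lower_unitriangular_def)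
  note inv = mat_inverse_mult[OF carrier]
  have det: "det \<xi> \<noteq> 0" using det_lower_unitriangular[of \<xi> q] \<xi> by (simp add: lower_unitriangular_def)
  have "vec q u = \<xi> *\<^sub>v vec q g"
    using assms(2) carrier
    by (intro eq_vecI) (auto simp: u right_recursion_polys_def scalar_prod_def lessThan_atLeast0)
  then have "the (mat_inverse \<xi>) *\<^sub>v vec q u = (the (mat_inverse \<xi>) * \<xi>) *\<^sub>v vec q g"
    using inv(3)[OF det] carrier by (simp add: assoc_mult_mat_vec[of _ q q _ q])
  then show ?thesis
    using inv(1)[OF det] \<open>b < q\<close> by simp
qed

lemma right_ev_expand:
  assumes q: "0 < q" and \<xi>: "lower_unitriangular q \<xi>" and rec: "right_recursion_polys q T \<xi> B"
  shows "right_ev q T B N k n = (\<Sum>b<q. poly (B b n) (eigval T N k) * christoffel_rho q T \<xi> B N k $ b)"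
proof -
  define g where "g b = beta q T N *
    poly (cofactor (mat q q (\<lambda>(i, c). B c (N + i))) 0 b) (eigval T N k)" for b
  have ev: "right_ev q T B N k n = (\<Sum>b<q. poly (B b n) (eigval T N k) * g b)" for n
    by (simp add: right_ev_def R_det_expand[OF q] poly_sum g_def sum_distrib_left mult_ac)
  have "christoffel_rho q T \<xi> B N k $ b = g b" if "b < q" for b
    unfolding christoffel_rho_def by (rule christoffel_coeff[OF \<xi> rec ev that])
  then show ?thesis by (simp add: ev)
qed

lemma left_ev_expand:
  assumes p: "0 < p" and \<nu>: "lower_unitriangular p \<nu>" and rec: "left_recursion_polys p T \<nu> A"
  shows "left_ev p T A N k n = (\<Sum>a<p. poly (A a n) (eigval T N k) * christoffel_mu p T \<nu> A N k $ a)"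
proof -
  define d where "d = poly (trunc_char_poly T N) (eigval T N k) *
      poly (pderiv (trunc_char_poly T (Suc N))) (eigval T N k)"
  define g where "g a = alpha p T N *
    poly (cofactor (mat p p (\<lambda>(i, c). A c (N + i))) 0 a) (eigval T N k) / d" for a
  have rec': "right_recursion_polys p (\<lambda>i j. T j i) \<nu> A"
    using rec by (simp add: left_recursion_polys_def right_recursion_polys_def)
  have QR: "Q_det p A n N = R_det p A n N" for n by (simp add: Q_det_def R_det_def)
  have ev: "left_ev p T A N k n = (\<Sum>a<p. poly (A a n) (eigval T N k) * g a)" for n
    by (simp add: left_ev_def QR R_det_expand[OF p] poly_sum g_def sum_distrib_left
        sum_divide_distrib mult_ac flip: d_def)
  have "christoffel_mu p T \<nu> A N k $ a = g a" if "a < p" for a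
    unfolding christoffel_mu_def by (rule christoffel_coeff[OF \<nu> rec' ev that])
  then show ?thesis by (simp add: ev)
qed

lemma right_ev_eq_adj:
  assumes "0 < q" "right_recursion_polys q T \<xi> B" "lower_unitriangular q \<xi>"
    "\<And>i j. i + q < j \<Longrightarrow> T i j = 0" "n \<le> N"
  shows "right_ev q T B N k n = poly (trunc_adj T (Suc N) n N) (eigval T N k)"
  using arg_cong[OF beta_R_det[OF assms], of "\<lambda>f. poly f (eigval T N k)"]
  by (simp add: right_ev_def)

lemma left_ev_eq_adj:
  assumes "0 < p" "left_recursion_polys p T \<nu> A" "lower_unitriangular p \<nu>"
    "\<And>i j. j + p < i \<Longrightarrow> T i j = 0" "n \<le> N"
  shows "left_ev p T A N k n = poly (trunc_adj T (Suc N) N n) (eigval T N k) /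
     (poly (trunc_char_poly T N) (eigval T N k) *
      poly (pderiv (trunc_char_poly T (Suc N))) (eigval T N k))"
proof -
  have "right_recursion_polys p (\<lambda>i j. T j i) \<nu> A"
    using assms(2) by (simp add: left_recursion_polys_def right_recursion_polys_def)
  from beta_R_det[OF assms(1) this assms(3) _ assms(5)] assms(4)
  have "Polynomial.smult (beta p (\<lambda>i j. T j i) N) (R_det p A n N) = trunc_adj (\<lambda>i j. T j i) (Suc N) n N"
    by blast
  also have "\<dots> = trunc_adj T (Suc N) N n"
    using assms(5) by (intro trunc_adj_transpose) auto
  finally have "trunc_adj T (Suc N) N n = Polynomial.smult (alpha p T N) (Q_det p A n N)"
    by (simp add: beta_def alpha_def Q_det_def R_det_def)
  then show ?thesis by (simp add: left_ev_def)
qed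

lemma trunc_adj_left_eigen:
  assumes "poly (trunc_char_poly T (Suc N)) x = 0" "j \<le> N"
  shows "(\<Sum>i\<le>N. poly (trunc_adj T (Suc N) N i) x * T i j) = x * poly (trunc_adj T (Suc N) N j) x"
proof -
  have "poly ([:0, 1:] * trunc_adj (\<lambda>i j. T j i) (Suc N) j N -
      (\<Sum>k<Suc N. Polynomial.smult (T k j) (trunc_adj (\<lambda>i j. T j i) (Suc N) k N))) x = 0"
    using trunc_charmat_mult_adj[of j "Suc N" N "\<lambda>i j. T j i"] assms
    by (simp add: trunc_char_poly_transpose[where T = T] del: sum.lessThan_Suc)
  then show ?thesis
    using assms(2)
    by (simp add: poly_sum trunc_adj_transpose[where T = T] lessThan_Suc_atMost mult.commute del: sum.lessThan_Suc)
qed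

text \<open>Pairing the left null vector \<open>w\<close> at \<open>x\<close> with \<open>X - T\<close> applied to the last column \<open>u\<close> of the
  adjugate gives \<open>(X - x) * (w \<bullet> u)\<close> on one side and a multiple of the characteristic polynomial on
  the other; differentiating at \<open>X = x\<close> gives the claim.\<close>

lemma trunc_adj_sum:
  assumes root: "poly (trunc_char_poly T (Suc N)) x = 0"
  shows "(\<Sum>n\<le>N. poly (trunc_adj T (Suc N) N n) x * poly (trunc_adj T (Suc N) n N) x) =
         poly (trunc_char_poly T N) x * poly (pderiv (trunc_char_poly T (Suc N))) x"
proof -
  define w where "w n = poly (trunc_adj T (Suc N) N n) x" for n
  define u where "u n = trunc_adj T (Suc N) n N" for n
  define S where "S = (\<Sum>n\<le>N. Polynomial.smult (w n) (u n))"
  let ?P = "trunc_char_poly T (Suc N)"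
  have "Polynomial.smult (w N) ?P = (\<Sum>n\<le>N. Polynomial.smult (w n) (if n = N then ?P else 0))"
    by (simp add: if_distrib cong: if_cong)
  also have "\<dots> = (\<Sum>n\<le>N. Polynomial.smult (w n) ([:0, 1:] * u n - (\<Sum>k\<le>N. Polynomial.smult (T n k) (u k))))"
  proof (rule sum.cong)
    fix n assume "n \<in> {..N}"
    then show "Polynomial.smult (w n) (if n = N then ?P else 0) =
      Polynomial.smult (w n) ([:0, 1:] * u n - (\<Sum>k\<le>N. Polynomial.smult (T n k) (u k)))"
      using trunc_charmat_mult_adj[of n "Suc N" N T]
      by (simp only: u_def lessThan_Suc_atMost atMost_iff less_Suc_eq_le)
  qed simp
  also have "\<dots> = [:0, 1:] * S - (\<Sum>n\<le>N. \<Sum>k\<le>N. Polynomial.smult (w n * T n k) (u k))"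
    by (simp add: smult_diff_right sum_subtractf smult_sum2 S_def sum_distrib_left del: mult_pCons_left)
  also have "(\<Sum>n\<le>N. \<Sum>k\<le>N. Polynomial.smult (w n * T n k) (u k)) =
      (\<Sum>k\<le>N. Polynomial.smult (\<Sum>n\<le>N. w n * T n k) (u k))"
    by (subst sum.swap) (simp add: smult_sum)
  also have "\<dots> = Polynomial.smult x S"
    using trunc_adj_left_eigen[OF root] by (simp add: S_def w_def smult_sum2)
  also have "[:0, 1:] * S - Polynomial.smult x S = [:- x, 1:] * S"
    by simp
  finally have "pderiv (Polynomial.smult (w N) ?P) = pderiv ([:- x, 1:] * S)"
    by simp
  then have "w N * poly (pderiv ?P) x = poly S x"
    by (subst (asm) pderiv_mult) (auto simp: pderiv_smult pderiv_pCons dest!: arg_cong[of _ _ "\<lambda>f. poly f x"])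
  then show ?thesis
    by (simp add: S_def w_def u_def poly_sum trunc_adj_corner)
qed

section \<open>Stationarity\<close>

lemma row_mult_eq_transpose:
  assumes "v \<in> carrier_vec n" "M \<in> carrier_mat n m"
  shows "row_mult v M = transpose_mat M *\<^sub>v v"
  using assms by (intro eq_vecI) (auto simp: row_mult_def comm_scalar_prod[of v n])

lemma row_mult_carrier [simp]: "M \<in> carrier_mat n m \<Longrightarrow> row_mult v M \<in> carrier_vec m"
  by (auto simp: row_mult_def)

lemma row_mult_mult:
  assumes "v \<in> carrier_vec n" "M \<in> carrier_mat n m" "K \<in> carrier_mat m l"
  shows "row_mult v (M * K) = row_mult (row_mult v M) K"
  using assms
  by (simp add: row_mult_eq_transpose[of v n _ l] row_mult_eq_transpose[of _ m _ l]
      transpose_mult[of M n m K l] row_mult_eq_transpose[of v n _ m] assoc_mult_mat_vec[of _ l m _ n])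

lemma row_mult_smult_mat:
  assumes "v \<in> carrier_vec n" "M \<in> carrier_mat n m"
  shows "row_mult v (c \<cdot>\<^sub>m M) = c \<cdot>\<^sub>v row_mult v M"
  using assms by (intro eq_vecI) (auto simp: row_mult_def)

lemma row_mult_smult_vec:
  assumes "v \<in> carrier_vec n" "M \<in> carrier_mat n m"
  shows "row_mult (c \<cdot>\<^sub>v v) M = c \<cdot>\<^sub>v row_mult v M"
  using assms by (intro eq_vecI) (auto simp: row_mult_def)

lemma row_mult_diag_of_vec:
  assumes "dim_vec v = dim_vec u" "m < dim_vec u"
  shows "row_mult v (diag_of_vec u) $ m = v $ m * u $ m"
  using assms
  by (simp add: row_mult_def diag_of_vec_def mat_diag_def scalar_prod_def if_distrib cong: if_cong)

lemma row_mult_conjugate_diag: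
  assumes w: "w \<in> carrier_vec n" and u: "u \<in> carrier_vec n" and M: "M \<in> carrier_mat n n"
    and eigen: "row_mult w M = c \<cdot>\<^sub>v w" and "c \<noteq> 0" and nz: "\<And>i. i < n \<Longrightarrow> u $ i \<noteq> 0"
  shows "row_mult (row_mult w (diag_of_vec u))
      ((1 / c) \<cdot>\<^sub>m (the (mat_inverse (diag_of_vec u)) * M * diag_of_vec u)) = row_mult w (diag_of_vec u)"
proof -
  let ?D = "diag_of_vec u"
  let ?E = "the (mat_inverse ?D)"
  have D: "?D \<in> carrier_mat n n"
    using u by (simp add: diag_of_vec_def)
  have "det ?D = prod_list (diag_mat ?D)"
    by (rule det_lower_triangular[OF _ D]) (use u in \<open>auto simp: diag_of_vec_def mat_diag_def\<close>)
  also have "\<dots> \<noteq> 0"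
    using u nz by (auto simp: diag_of_vec_def mat_diag_def diag_mat_def prod_list_zero_iff)
  finally have det: "det ?D \<noteq> 0" .
  note E = mat_inverse_mult[OF D det]
  have "row_mult (row_mult w ?D) ((1 / c) \<cdot>\<^sub>m (?E * M * ?D)) = (1 / c) \<cdot>\<^sub>v row_mult (row_mult w ?D) (?E * M * ?D)"
    using w D E M by (intro row_mult_smult_mat[of _ n _ n]) auto
  also have "row_mult (row_mult w ?D) (?E * M * ?D) = row_mult (row_mult (row_mult w (?D * ?E)) M) ?D"
    using w D E(3) M by (simp add: row_mult_mult[of _ n _ n _ n])
  also have "row_mult w (?D * ?E) = w"
    using w by (intro eq_vecI) (auto simp: E row_mult_def)
  also have "row_mult (row_mult w M) ?D = c \<cdot>\<^sub>v row_mult w ?D"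
    unfolding eigen by (rule row_mult_smult_vec[OF w D])
  also have "(1 / c) \<cdot>\<^sub>v (c \<cdot>\<^sub>v row_mult w ?D) = row_mult w ?D"
    using \<open>c \<noteq> 0\<close> by (simp add: smult_smult_assoc)
  finally show ?thesis .
qed

theorem theorem2p13:
  fixes p q N :: nat
    and T :: imat
    and \<nu> \<xi> :: "real mat"
    and A B :: "nat \<Rightarrow> nat \<Rightarrow> real poly"
  assumes "1 \<le> p" and "1 \<le> q"
    and "stochastic_imat T"
    and "positive_banded p q T"
    and "has_pos_bidiagonal_factorization p q T"
    and "lower_unitriangular p \<nu>"
    and "lower_unitriangular q \<xi>"
    and "left_recursion_polys p T \<nu> A"
    and "right_recursion_polys q T \<xi> B"
  shows "(\<forall>m\<le>N.
            pi_dist p q T A B N $ m = right_ev q T B N 0 m * left_ev p T A N 0 m \<and>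
            pi_dist p q T A B N $ m =
              (\<Sum>a<p. \<Sum>b<q. poly (B b m) (eigval T N 0) * poly (A a m) (eigval T N 0) *
                 christoffel_rho q T \<xi> B N 0 $ b * christoffel_mu p T \<nu> A N 0 $ a) \<and>
            pi_dist p q T A B N $ m =
              alpha p T N * beta q T N *
                poly (Q_det p A m N) (eigval T N 0) * poly (R_det q B m N) (eigval T N 0) /
              (poly (trunc_char_poly T N) (eigval T N 0) *
               poly (pderiv (trunc_char_poly T (Suc N))) (eigval T N 0))) \<and>
         probability_vec (pi_dist p q T A B N) \<and>
         row_mult (pi_dist p q T A B N) (T_hat q T B N) = pi_dist p q T A B N"
proof -
  have p: "0 < p" and q: "0 < q" using assms(1,2) by auto
  have band: "\<And>i j. i + q < j \<Longrightarrow> T i j = 0" "\<And>i j. j + p < i \<Longrightarrow> T i j = 0"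
    and pos: "\<And>i j. i \<le> j + p \<Longrightarrow> j \<le> i + q \<Longrightarrow> 0 < T i j"
    using assms(4) by (auto simp: positive_banded_def not_le)
  have nonneg: "0 \<le> T i j" for i j
    using assms(3) by (simp add: stochastic_imat_def)
  let ?r = "eigval T N 0" and ?G = "trunc_adj T (Suc N)"
  let ?P = "trunc_char_poly T N" and ?P' = "trunc_char_poly T (Suc N)"
  obtain r where "r > 0" and root: "poly ?P' r = 0" and above: "\<And>x. r < x \<Longrightarrow> 0 < poly ?P' x"
    and adj: "\<And>i j. i \<le> N \<Longrightarrow> j \<le> N \<Longrightarrow> 0 < poly (?G i j) r"
    using trunc_adj_perron[where T = T and n = N, OF nonneg pos pos pos] p q by auto
  have r: "eigval T N 0 = r" by (rule eigval_0_eq[OF root above])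
  define d where "d = poly ?P r * poly (pderiv ?P') r"
  define w where "w = vec (Suc N) (left_ev p T A N 0)"
  define u where "u = vec (Suc N) (right_ev q T B N 0)"
  have ev_u: "right_ev q T B N 0 n = poly (?G n N) r" if "n \<le> N" for n
    using right_ev_eq_adj[OF q assms(9,7) band(1) that] by (simp add: r)
  have ev_w: "left_ev p T A N 0 n = poly (?G N n) r / d" if "n \<le> N" for n
    using left_ev_eq_adj[OF p assms(8,6) band(2) that] by (simp add: r d_def)
  have sum_d: "(\<Sum>n\<le>N. poly (?G N n) r * poly (?G n N) r) = d"
    unfolding d_def by (rule trunc_adj_sum[OF root])
  have "0 < (\<Sum>n\<le>N. poly (?G N n) r * poly (?G n N) r)"
    by (rule sum_pos) (simp_all add: adj)
  then have "d > 0" by (simp add: sum_d)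
  have pi: "pi_dist p q T A B N = row_mult w (diag_of_vec u)"
    by (simp add: pi_dist_def w_def u_def)
  have dim: "dim_vec (pi_dist p q T A B N) = Suc N"
    by (simp add: pi u_def row_mult_def diag_of_vec_def mat_diag_def)
  have pi_m: "pi_dist p q T A B N $ m = right_ev q T B N 0 m * left_ev p T A N 0 m" if "m \<le> N" for m
    using that unfolding pi by (subst row_mult_diag_of_vec) (simp_all add: w_def u_def)
  have pi_sum: "pi_dist p q T A B N $ m =
      (\<Sum>a<p. \<Sum>b<q. poly (B b m) ?r * poly (A a m) ?r *
         christoffel_rho q T \<xi> B N 0 $ b * christoffel_mu p T \<nu> A N 0 $ a)" if "m \<le> N" for m
    unfolding pi_m[OF that] right_ev_expand[OF q assms(7,9)] left_ev_expand[OF p assms(6,8)]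
    unfolding sum_product by (subst sum.swap) (simp add: mult_ac)
  have pi_det: "pi_dist p q T A B N $ m =
      alpha p T N * beta q T N * poly (Q_det p A m N) ?r * poly (R_det q B m N) ?r /
      (poly ?P ?r * poly (pderiv ?P') ?r)" if "m \<le> N" for m
    unfolding pi_m[OF that] by (simp add: right_ev_def left_ev_def mult_ac)
  have prob: "probability_vec (pi_dist p q T A B N)"
    unfolding probability_vec_def
  proof
    show "\<forall>i<dim_vec (pi_dist p q T A B N). 0 \<le> pi_dist p q T A B N $ i"
      using adj \<open>d > 0\<close> by (simp add: dim pi_m ev_u ev_w less_Suc_eq_le less_imp_le)
    have "(\<Sum>i\<le>N. pi_dist p q T A B N $ i) = (\<Sum>n\<le>N. poly (?G N n) r * poly (?G n N) r) / d"
      unfolding sum_divide_distrib by (rule sum.cong) (simp_all add: pi_m ev_u ev_w)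
    then show "(\<Sum>i<dim_vec (pi_dist p q T A B N). pi_dist p q T A B N $ i) = 1"
      using \<open>d > 0\<close> by (simp only: dim lessThan_Suc_atMost sum_d) simp
  qed
  have "row_mult w (trunc T N) = r \<cdot>\<^sub>v w"
  proof (rule eq_vecI)
    fix j assume "j < dim_vec (r \<cdot>\<^sub>v w)"
    then have "j \<le> N" by (simp add: w_def)
    then have "row_mult w (trunc T N) $ j = (\<Sum>i\<le>N. poly (?G N i) r * T i j) / d"
      by (auto simp: row_mult_def trunc_def scalar_prod_def w_def ev_w sum_divide_distrib
          atLeast0LessThan lessThan_Suc_atMost intro!: sum.cong simp del: sum.op_ivl_Suc sum.lessThan_Suc)
    then show "row_mult w (trunc T N) $ j = (r \<cdot>\<^sub>v w) $ j"
      using \<open>j \<le> N\<close> by (simp add: trunc_adj_left_eigen[OF root] w_def ev_w)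
  qed (simp add: row_mult_def trunc_def w_def)
  then have stat: "row_mult (pi_dist p q T A B N) (T_hat q T B N) = pi_dist p q T A B N"
    using row_mult_conjugate_diag[of w "Suc N" u "trunc T N" r] \<open>r > 0\<close> adj
    by (simp add: pi T_hat_def Let_def r w_def u_def trunc_def ev_u less_Suc_eq_le less_imp_neq[symmetric])
  show ?thesis
    using pi_m pi_sum pi_det prob stat by blast
qed

end
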